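(* Fix $\alpha,G>0$, an integer $N\ge 5$, and an integer $1\le k\le 6N$. For every deterministic method using at most $\lfloor N/(4k)\rfloor$ calls to a $k$-fold sparse projection oracle, there exists an instance in dimension $n=6N$ with compact (convex) feasible set $\mathcal K\subset\mathbb R^{6N}$, an $\alpha$-strongly convex objective $f:\mathbb R^{6N}\to\mathbb R$ whose feasible subgradients have norm at most $G$ (i.e. $\|g\|\le G$ for all $w\in\mathcal K$, $g\in\partial f(w)$), and a unique minimizer $w^*$ of $f$ over $\mathcal K$, which is a vertex of $\mathcal K$, such that the point $\widehat w$ returned by the method is either infeasible ($\widehat w\notin\mathcal K$) or satisfies $$ f(\widehat w)-f(w^* )\ \ge\ \frac{G^2}{36\,\alpha N}. $$ Arbitrarily many first-order calls to $f$ between sparse projections are allowed. Consequently, there is a universal constant $c_0>0$ such that, whenever $G^2/(\alpha\epsilon k)$ is sufficiently large, every deterministic method that guarantees an $\epsilon$-optimal feasible point on all such instances requires at least $c_0G^2/(\alpha\epsilon k)$ $k$-fold sparse projections in the worst case.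
   Context: Problem: minimize $F=f+I_{\mathcal K}$, i.e. minimize a convex $f$ over a convex compact set $\mathcal K=\mathrm{conv}(\mathcal V)\subset\mathbb R^n$, where $\mathcal V$ is the set of vertices (extreme points) of $\mathcal K$; norms are Euclidean. All instances are such that the unique minimizer is a single vertex. $k$-fold sparse projection oracle (for the case in which the optimal solution is a single vertex): for $k\le n$, let $\mathcal C_k=\{\sum_{i=1}^p\lambda_i v_i:\ p\le k,\ v_i\in\mathcal V,\ \lambda_i\ge 0,\ \sum_i\lambda_i=1\}$ (a generally nonconvex subset of $\mathcal K$). The oracle, given any $y\in\mathbb R^n$, outputs a point of $\arg\min_{z\in\mathcal C_k}\|z-y\|$; ties are broken by a deterministic rule that is part of the instance. Access model: the method is not given an explicit description of $\mathcal K$; its only access to $\mathcal K$ is through calls to the $k$-fold sparse projection oracle. It may otherwise perform arbitrary computations and make arbitrarily many calls to a first-order oracle for $f$ (which at a query $w$ returns $f(w)$ and a subgradient of $f$ at $w$ chosen by a deterministic rule that is part of the instance). A deterministic method is a deterministic rule which, as a function of all oracle answers received so far, chooses the next oracle and query, or stops and returns a point $\widehat w\in\mathbb R^n$. An $\epsilon$-optimal feasible point is $\widehat w\in\mathcal K$ with $f(\widehat w)-\min_{\mathcal K}f\le\epsilon$. The instance in the statement may depend on the method. *)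

theory Defs
  imports "HOL-Analysis.Analysis"
begin

section \<open>Euclidean spaces of variable dimension\<close>

text \<open>
  The dimension is quantified inside the statement, so it cannot be a type. All spaces $\mathbb{R}^n$
  live side by side in the inner product space of finitely supported real sequences: \<open>Rn n\<close> is the
  subspace of sequences supported on \<open>{..<n}\<close>. The class operations \<open>inner\<close>, \<open>norm\<close> and the
  topology restrict on \<open>Rn n\<close> to the usual Euclidean ones (see \<open>inner_Rn\<close>, \<open>norm_Rn\<close>).
\<close>

typedef fvec = "{x :: nat \<Rightarrow> real. finite {i. x i \<noteq> 0}}"
  morphisms coord Abs_fvec
  by (rule exI[of _ "\<lambda>_. 0"]) simp

setup_lifting type_definition_fvec

lemma fvec_eqI: "(\<And>i. coord x i = coord y i) \<Longrightarrow> x = y"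
  by (simp add: coord_inject[symmetric] fun_eq_iff)

lemma finite_support [simp]: "finite {i. coord x i \<noteq> 0}"
  using coord[of x] by simp

instantiation fvec :: real_vector
begin

lift_definition zero_fvec :: fvec is "\<lambda>_. 0" by simp

lift_definition plus_fvec :: "fvec \<Rightarrow> fvec \<Rightarrow> fvec" is "\<lambda>x y i. x i + y i"
  by (erule (1) rev_finite_subset[OF finite_UnI]) auto

lift_definition minus_fvec :: "fvec \<Rightarrow> fvec \<Rightarrow> fvec" is "\<lambda>x y i. x i - y i"
  by (erule (1) rev_finite_subset[OF finite_UnI]) auto

lift_definition uminus_fvec :: "fvec \<Rightarrow> fvec" is "\<lambda>x i. - x i" by simp

lift_definition scaleR_fvec :: "real \<Rightarrow> fvec \<Rightarrow> fvec" is "\<lambda>c x i. c * x i"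
  by (erule rev_finite_subset) auto

instance
  by standard (transfer; simp add: fun_eq_iff algebra_simps)+

end

lemma coord_simps [simp]:
  "coord 0 i = 0" "coord (x + y) i = coord x i + coord y i"
  "coord (x - y) i = coord x i - coord y i" "coord (- x) i = - coord x i"
  "coord (c *\<^sub>R x) i = c * coord x i"
  by (transfer; simp)+

lemma coord_sum [simp]: "coord (\<Sum>j\<in>A. f j) i = (\<Sum>j\<in>A. coord (f j) i)"
  by (induction A rule: infinite_finite_induct) auto

instantiation fvec :: real_inner
begin

definition inner_fvec :: "fvec \<Rightarrow> fvec \<Rightarrow> real" where
  "inner_fvec x y = (\<Sum>i | coord x i \<noteq> 0. coord x i * coord y i)"

definition norm_fvec :: "fvec \<Rightarrow> real" where
  "norm_fvec x = sqrt (inner x x)"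

definition sgn_fvec :: "fvec \<Rightarrow> fvec" where
  "sgn_fvec x = x /\<^sub>R norm x"

definition dist_fvec :: "fvec \<Rightarrow> fvec \<Rightarrow> real" where
  "dist_fvec x y = norm (x - y)"

definition uniformity_fvec :: "(fvec \<times> fvec) filter" where
  "uniformity_fvec = (INF e\<in>{0<..}. principal {(x, y). dist x y < e})"

definition open_fvec :: "fvec set \<Rightarrow> bool" where
  "open_fvec U \<longleftrightarrow> (\<forall>x\<in>U. \<forall>\<^sub>F (x', y) in uniformity. x' = x \<longrightarrow> y \<in> U)"

lemma inner_fvec_superset:
  assumes "finite A" "{i. coord x i \<noteq> 0} \<subseteq> A"
  shows "inner x y = (\<Sum>i\<in>A. coord x i * coord y i)"
  unfolding inner_fvec_def by (rule sum.mono_neutral_left) (use assms in auto)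

instance
proof
  fix x y z :: fvec and c :: real
  let ?A = "{i. coord x i \<noteq> 0} \<union> {i. coord y i \<noteq> 0}"
  have A: "finite ?A" by simp
  show "inner x y = inner y x"
    by (subst (1 2) inner_fvec_superset[OF A]) (auto simp: mult.commute)
  show "inner (x + y) z = inner x z + inner y z"
    by (subst (1 2 3) inner_fvec_superset[OF A]) (auto simp: sum.distrib algebra_simps)
  show "inner (c *\<^sub>R x) y = c * inner x y"
    by (subst (1 2) inner_fvec_superset[OF A]) (auto simp: sum_distrib_left algebra_simps)
  show "0 \<le> inner x x"
    by (simp add: inner_fvec_def sum_nonneg)
  show "inner x x = 0 \<longleftrightarrow> x = 0"
    by (auto simp: inner_fvec_def sum_nonneg_eq_0_iff intro: fvec_eqI)
qed (rule sgn_fvec_def dist_fvec_def uniformity_fvec_def open_fvec_def norm_fvec_def)+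

end

definition Rn :: "nat \<Rightarrow> fvec set" where
  "Rn n = {x. \<forall>i\<ge>n. coord x i = 0}"

lemma inner_Rn: "x \<in> Rn n \<Longrightarrow> inner x y = (\<Sum>i<n. coord x i * coord y i)"
  by (rule inner_fvec_superset) (auto simp: Rn_def not_le[symmetric])

lemma norm_Rn: "x \<in> Rn n \<Longrightarrow> norm x = sqrt (\<Sum>i<n. (coord x i)\<^sup>2)"
  by (simp add: norm_eq_sqrt_inner inner_Rn power2_eq_square)

lemma subspace_Rn: "subspace (Rn n)"
  by (auto simp: subspace_def Rn_def)

lemma coord_image_Rn: "coord ` Rn n = {x. \<forall>i\<ge>n. x i = 0}"
proof -
  have "x \<in> coord ` Rn n" if "\<forall>i\<ge>n. x i = 0" for x
  proof -
    have "{i. x i \<noteq> 0} \<subseteq> {..<n}" using that by (auto simp: not_le[symmetric])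
    then have "finite {i. x i \<noteq> 0}" by (rule finite_subset) simp
    then have "coord (Abs_fvec x) = x" by (simp add: Abs_fvec_inverse)
    with that show ?thesis by (auto simp: Rn_def intro!: image_eqI[of _ _ "Abs_fvec x"])
  qed
  then show ?thesis by (auto simp: Rn_def)
qed

section \<open>Convexity notions\<close>

definition strongly_convex_on :: "'a::real_inner set \<Rightarrow> real \<Rightarrow> ('a \<Rightarrow> real) \<Rightarrow> bool" where
  "strongly_convex_on S \<alpha> f \<longleftrightarrow> convex S \<and>
     (\<forall>x\<in>S. \<forall>y\<in>S. \<forall>u\<ge>0. \<forall>v\<ge>0. u + v = 1 \<longrightarrow>
        f (u *\<^sub>R x + v *\<^sub>R y) \<le> u * f x + v * f y - \<alpha> / 2 * u * v * (norm (x - y))\<^sup>2)"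

text \<open>\<open>E\<close> is the ambient space: both the subgradients and the test points range over it.\<close>

definition subdifferential :: "'a::real_inner set \<Rightarrow> ('a \<Rightarrow> real) \<Rightarrow> 'a \<Rightarrow> 'a set" where
  "subdifferential E f w = {g \<in> E. \<forall>y\<in>E. f y \<ge> f w + inner g (y - w)}"

definition vertices :: "'a::real_vector set \<Rightarrow> 'a set" where
  "vertices K = {v. v extreme_point_of K}"

definition sparse_hull :: "nat \<Rightarrow> 'a::real_vector set \<Rightarrow> 'a set" where
  "sparse_hull k V = {\<Sum>i=1..p. l i *\<^sub>R v i | p l v.
     p \<le> k \<and> (\<forall>i\<in>{1..p}. v i \<in> V \<and> l i \<ge> (0::real)) \<and> (\<Sum>i=1..p. l i) = 1}"

section \<open>Problem instances\<close>

text \<open>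
  \<open>projection\<close> and \<open>subgrad\<close> are the deterministic answering rules of the two oracles; being
  functions of the query, they include the tie-breaking. Only their values on the ambient space
  \<open>Rn n\<close> matter, and likewise for \<open>objective\<close>.
\<close>

record problem =
  feasible :: "fvec set"
  objective :: "fvec \<Rightarrow> real"
  projection :: "fvec \<Rightarrow> fvec"
  subgrad :: "fvec \<Rightarrow> fvec"

definition unique_minimizer :: "problem \<Rightarrow> fvec \<Rightarrow> bool" where
  "unique_minimizer P w \<longleftrightarrow> {x. is_arg_min (objective P) (\<lambda>x. x \<in> feasible P) x} = {w}"

definition admissible :: "real \<Rightarrow> real \<Rightarrow> nat \<Rightarrow> nat \<Rightarrow> problem \<Rightarrow> bool" where
  "admissible \<alpha> G n k P \<longleftrightarrow>
     feasible P \<subseteq> Rn n \<and> compact (feasible P) \<and> convex (feasible P) \<and>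
     feasible P = convex hull vertices (feasible P) \<and>
     strongly_convex_on (Rn n) \<alpha> (objective P) \<and>
     (\<forall>w\<in>feasible P. \<forall>g\<in>subdifferential (Rn n) (objective P) w. norm g \<le> G) \<and>
     (\<exists>w\<in>vertices (feasible P). unique_minimizer P w) \<and>
     (\<forall>y\<in>Rn n. is_arg_min (\<lambda>z. norm (z - y))
        (\<lambda>z. z \<in> sparse_hull k (vertices (feasible P))) (projection P y)) \<and>
     (\<forall>w\<in>Rn n. subgrad P w \<in> subdifferential (Rn n) (objective P) w)"

definition eps_optimal :: "problem \<Rightarrow> real \<Rightarrow> fvec \<Rightarrow> bool" where
  "eps_optimal P \<epsilon> w \<longleftrightarrow>
     w \<in> feasible P \<and> objective P w - (INF x\<in>feasible P. objective P x) \<le> \<epsilon>"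

section \<open>Deterministic methods\<close>

datatype action = Project (arg: fvec) | Evaluate (arg: fvec) | Return (arg: fvec)

datatype answer = is_Point: Point fvec | FirstOrder real fvec

text \<open>A method maps the list of all answers received so far, oldest first, to its next action.\<close>

type_synonym rule = "answer list \<Rightarrow> action"

definition method_in_dim :: "nat \<Rightarrow> rule \<Rightarrow> bool" where
  "method_in_dim n M \<longleftrightarrow> (\<forall>h. arg (M h) \<in> Rn n)"

inductive history :: "rule \<Rightarrow> problem \<Rightarrow> answer list \<Rightarrow> bool" for M P where
  start: "history M P []"
| project: "history M P h \<Longrightarrow> M h = Project y \<Longrightarrow> history M P (h @ [Point (projection P y)])"
| evaluate: "history M P h \<Longrightarrow> M h = Evaluate w \<Longrightarrow>
    history M P (h @ [FirstOrder (objective P w) (subgrad P w)])"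

text \<open>On \<open>P\<close> the method stops with complete answer history \<open>h\<close> and returns \<open>w\<close>.\<close>

definition outputs :: "rule \<Rightarrow> problem \<Rightarrow> answer list \<Rightarrow> fvec \<Rightarrow> bool" where
  "outputs M P h w \<longleftrightarrow> history M P h \<and> M h = Return w"

definition projection_calls :: "answer list \<Rightarrow> nat" where
  "projection_calls h = length (filter is_Point h)"

end

theory Submission
  imports Defs
begin

text \<open>
  A resisting oracle. The objective is $\beta \sum_{i<N} |w_i| + \frac{\alpha}{2} \|w\|^2$ with
  $\beta = G / (2 \sqrt N)$, so only $\mathcal{K}$ is hidden. All vertices are orthogonal of norm
  $c = \beta / \alpha$. To each new query $y$ the oracle commits $k$ fresh vertices $\pm c e_j$ with
  $j < N$ and $|y_j|$ as large as possible, the sign being that of $y_j$: then no other vertex, neither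
  a later $\pm c e_j$ nor a vector orthogonal to $y$, can improve on a $k$-sparse combination of those
  already committed. The minimizer $w^*$ has norm $c$, is supported on the coordinates from $N$ on, and is
  chosen at the very end orthogonal to all queries and to the returned point. Its value is
  $\frac{\alpha}{2} c^2$, whereas a feasible point orthogonal to $w^*$ is a convex combination of the
  vertices $\pm c e_j$ and has value at least $\beta c = \alpha c^2$.
\<close>

section \<open>Sparse hulls of finite sets\<close>

text \<open>Repeated vertices in a combination can be merged, so only the set of vertices used
  matters; the empty combination is ruled out since its weights do not sum to 1. In this form the
  nonconvex sparse hull is a finite union of compact hulls, hence compact, and projections onto it
  exist.\<close>

lemma sparse_hull_finite:
  assumes "finite V"
  shows "sparse_hull k V = (\<Union>S\<in>{S. S \<subseteq> V \<and> card S \<le> k}. convex hull S)"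
proof (intro set_eqI iffI)
  fix z assume "z \<in> sparse_hull k V"
  then obtain p l v where p: "p \<le> k" and v: "\<forall>i\<in>{1..p}. v i \<in> V \<and> l i \<ge> (0::real)"
    and l: "(\<Sum>i=1..p. l i) = 1" and z: "z = (\<Sum>i=1..p. l i *\<^sub>R v i)"
    unfolding sparse_hull_def by blast
  have "(\<Sum>i=1..p. l i *\<^sub>R v i) \<in> convex hull (v ` {1..p})"
    by (rule convex_sum) (use v l in \<open>auto intro: hull_inc\<close>)
  moreover have "v ` {1..p} \<subseteq> V" "card (v ` {1..p}) \<le> k"
    using v p card_image_le[of "{1..p}" v] by auto
  ultimately show "z \<in> (\<Union>S\<in>{S. S \<subseteq> V \<and> card S \<le> k}. convex hull S)"
    unfolding z by blast
next
  fix z assume "z \<in> (\<Union>S\<in>{S. S \<subseteq> V \<and> card S \<le> k}. convex hull S)"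
  then obtain S where S: "S \<subseteq> V" "card S \<le> k" "z \<in> convex hull S" by blast
  have "finite S" using S(1) assms finite_subset by blast
  then obtain u where u: "\<forall>x\<in>S. 0 \<le> u x" "sum u S = 1" "(\<Sum>x\<in>S. u x *\<^sub>R x) = z"
    using S(3) by (auto simp: convex_hull_finite)
  obtain b where b: "bij_betw b {1..card S} S"
    using ex_bij_betw_nat_finite_1[OF \<open>finite S\<close>] by blast
  have "z = (\<Sum>i=1..card S. u (b i) *\<^sub>R b i)"
    using sum.reindex_bij_betw[OF b, of "\<lambda>x. u x *\<^sub>R x"] u(3) by simp
  moreover have "(\<Sum>i=1..card S. u (b i)) = 1"
    using sum.reindex_bij_betw[OF b, of u] u(2) by simp
  moreover have "\<forall>i\<in>{1..card S}. b i \<in> V \<and> u (b i) \<ge> 0"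
    using b S(1) u(1) by (auto simp: bij_betw_def)
  ultimately have "z = (\<Sum>i=1..card S. u (b i) *\<^sub>R b i) \<and> card S \<le> k \<and>
      (\<forall>i\<in>{1..card S}. b i \<in> V \<and> u (b i) \<ge> 0) \<and> (\<Sum>i=1..card S. u (b i)) = 1"
    using S(2) by (intro conjI)
  then show "z \<in> sparse_hull k V"
    unfolding sparse_hull_def by (intro CollectI) (rule exI)+
qed

lemma sparse_hull_mono: "V \<subseteq> W \<Longrightarrow> sparse_hull k V \<subseteq> sparse_hull k W"
  unfolding sparse_hull_def by blast

lemma compact_sparse_hull:
  fixes V :: "'a::real_normed_vector set"
  assumes "finite V"
  shows "compact (sparse_hull k V)"
proof -
  have "finite {S. S \<subseteq> V \<and> card S \<le> k}"
    by (rule finite_subset[of _ "Pow V"]) (use assms in auto)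
  then show ?thesis
    unfolding sparse_hull_finite[OF assms]
    by (intro compact_UN) (use assms in \<open>auto intro: finite_imp_compact_convex_hull finite_subset\<close>)
qed

lemma sparse_hull_arg_min_exists:
  fixes y :: "'a::real_normed_vector"
  assumes "finite V" "V \<noteq> {}" "k \<ge> 1"
  shows "\<exists>x. is_arg_min (\<lambda>z. norm (z - y)) (\<lambda>z. z \<in> sparse_hull k V) x"
proof -
  obtain v where "v \<in> V" using assms by blast
  then have "v \<in> sparse_hull k V"
    unfolding sparse_hull_finite[OF assms(1)] using assms(3) by (auto intro!: exI[of _ "{v}"])
  then have "\<exists>x\<in>sparse_hull k V. \<forall>z\<in>sparse_hull k V. norm (x - y) \<le> norm (z - y)"
    by (intro continuous_attains_inf compact_sparse_hull assms continuous_intros) auto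
  then show ?thesis by (auto simp: is_arg_min_def not_less)
qed

section \<open>Exchanging vertices that are orthogonal and of equal norm\<close>

lemma norm_sum_orthogonal:
  fixes g :: "'b \<Rightarrow> 'a::real_inner"
  assumes "finite S" "inj_on g S" "g ` S \<subseteq> W"
    and "\<And>u. u \<in> W \<Longrightarrow> norm u = c"
    and "\<And>u v. u \<in> W \<Longrightarrow> v \<in> W \<Longrightarrow> u \<noteq> v \<Longrightarrow> inner u v = 0"
  shows "(norm (\<Sum>x\<in>S. m x *\<^sub>R g x))\<^sup>2 = (\<Sum>x\<in>S. (m x)\<^sup>2 * c\<^sup>2)"
proof -
  have "(norm (\<Sum>x\<in>S. m x *\<^sub>R g x))\<^sup>2 = (\<Sum>x\<in>S. (norm (m x *\<^sub>R g x))\<^sup>2)"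
  proof (rule norm_sum_Pythagorean[OF assms(1)])
    show "pairwise (\<lambda>i j. orthogonal (m i *\<^sub>R g i) (m j *\<^sub>R g j)) S"
    proof (rule pairwiseI)
      fix x y assume "x \<in> S" "y \<in> S" "x \<noteq> y"
      then have "inner (g x) (g y) = 0"
        using inj_onD[OF assms(2), of x y] assms(3) by (intro assms(5)) auto
      then show "orthogonal (m x *\<^sub>R g x) (m y *\<^sub>R g y)" by (simp add: orthogonal_def)
    qed
  qed
  also have "\<dots> = (\<Sum>x\<in>S. (m x)\<^sup>2 * c\<^sup>2)"
    by (rule sum.cong) (use assms(3,4) in \<open>auto simp: power_mult_distrib\<close>)
  finally show ?thesis .
qed

text \<open>Replacing, in a sparse combination, each vertex outside \<open>V\<close> by an unused element of \<open>F\<close> keeps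
  the norm and does not decrease the inner product with \<open>y\<close>.\<close>

lemma sparse_hull_exchange:
  fixes y :: "'a::real_inner"
  assumes fin: "finite W" and VW: "V \<subseteq> W" and F: "F \<subseteq> V" "k \<le> card F"
    and nrm: "\<And>u. u \<in> W \<Longrightarrow> norm u = c"
    and orth: "\<And>u v. u \<in> W \<Longrightarrow> v \<in> W \<Longrightarrow> u \<noteq> v \<Longrightarrow> inner u v = 0"
    and dom: "\<And>u v. u \<in> W - V \<Longrightarrow> v \<in> F \<Longrightarrow> inner u y \<le> inner v y"
    and z: "z \<in> sparse_hull k W"
  shows "\<exists>z'\<in>sparse_hull k V. norm (z' - y) \<le> norm (z - y)"
proof -
  obtain S where S: "S \<subseteq> W" "card S \<le> k" "z \<in> convex hull S"
    using z unfolding sparse_hull_finite[OF fin] by blast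
  have finS: "finite S" using S(1) fin finite_subset by blast
  have finV: "finite V" using VW fin finite_subset by blast
  have finF: "finite F" using F(1) finV finite_subset by blast
  obtain m where m: "\<forall>x\<in>S. 0 \<le> m x" "sum m S = 1" "(\<Sum>x\<in>S. m x *\<^sub>R x) = z"
    using S(3) finS by (auto simp: convex_hull_finite)
  have "card (S - V) \<le> card (F - S)"
  proof -
    have "card S = card (S \<inter> V) + card (S - V)" "card F = card (F \<inter> S) + card (F - S)"
      by (simp_all add: card_Int_Diff finS finF)
    moreover have "card (F \<inter> S) \<le> card (S \<inter> V)"
      by (rule card_mono) (use F finS in auto)
    ultimately show ?thesis using S(2) F(2) by linarith
  qed
  then obtain h where h: "h ` (S - V) \<subseteq> F - S" "inj_on h (S - V)"
    using card_le_inj[of "S - V" "F - S"] finS finF by auto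
  define g where "g x = (if x \<in> V then x else h x)" for x
  have inj: "inj_on g S"
    using h by (auto simp: inj_on_def g_def)
  have gV: "g ` S \<subseteq> V" using h F by (auto simp: g_def)
  define z' where "z' = (\<Sum>x\<in>S. m x *\<^sub>R g x)"
  have "z' \<in> convex hull (g ` S)"
    unfolding z'_def by (rule convex_sum) (use m finS in \<open>auto intro: hull_inc\<close>)
  moreover have "card (g ` S) \<le> k" using card_image_le[OF finS, of g] S(2) by linarith
  ultimately have z'mem: "z' \<in> sparse_hull k V"
    unfolding sparse_hull_finite[OF finV] using gV by blast
  have n1: "(norm z')\<^sup>2 = (\<Sum>x\<in>S. (m x)\<^sup>2 * c\<^sup>2)"
    unfolding z'_def by (rule norm_sum_orthogonal[OF finS inj _ nrm orth]) (use gV VW in auto)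
  have n2: "(norm z)\<^sup>2 = (\<Sum>x\<in>S. (m x)\<^sup>2 * c\<^sup>2)"
    using norm_sum_orthogonal[of S "\<lambda>x. x" W c m, OF finS _ _ nrm orth] S(1) m(3) by auto
  have "inner x y \<le> inner (g x) y" if "x \<in> S" for x
    using that dom[of x "h x"] S(1) h(1) by (auto simp: g_def)
  then have "inner z y \<le> inner z' y"
    unfolding z'_def m(3)[symmetric] inner_sum_left inner_scaleR_left
    by (intro sum_mono mult_left_mono) (use m in auto)
  \<comment> \<open>With equal norms of \<open>z\<close> and \<open>z'\<close>, the squared
    distances to \<open>y\<close> differ only in the inner product with \<open>y\<close>.\<close>
  then have "(norm (z' - y))\<^sup>2 \<le> (norm (z - y))\<^sup>2"
    using n1 n2 by (simp add: power2_norm_eq_inner inner_diff_left inner_diff_right inner_commute)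
  then show ?thesis using z'mem by (auto dest: power2_le_imp_le)
qed

text \<open>By the exchange, a larger vertex set offers no point closer to \<open>y\<close>. This
  lets an oracle answer given for the vertices committed so far stay correct, both when further
  vertices are committed and when the hidden minimizer is added.\<close>

lemma sparse_hull_arg_min_extend:
  fixes y :: "'a::real_inner"
  assumes "finite W" "V \<subseteq> W" "F \<subseteq> V" "k \<le> card F"
    and "\<And>u. u \<in> W \<Longrightarrow> norm u = c"
    and "\<And>u v. u \<in> W \<Longrightarrow> v \<in> W \<Longrightarrow> u \<noteq> v \<Longrightarrow> inner u v = 0"
    and "\<And>u v. u \<in> W - V \<Longrightarrow> v \<in> F \<Longrightarrow> inner u y \<le> inner v y"
    and "is_arg_min (\<lambda>z. norm (z - y)) (\<lambda>z. z \<in> sparse_hull k V) x"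
  shows "is_arg_min (\<lambda>z. norm (z - y)) (\<lambda>z. z \<in> sparse_hull k W) x"
proof -
  have "\<exists>z'\<in>sparse_hull k V. norm (z' - y) \<le> norm (z - y)" if "z \<in> sparse_hull k W" for z
    by (rule sparse_hull_exchange[where F = F and W = W and c = c]) (fact assms that)+
  then show ?thesis
    using sparse_hull_mono[OF assms(2), of k] assms(8)
    unfolding is_arg_min_def by (meson le_less_trans subsetD)
qed

section \<open>Extreme points of a hull spanned by points of a sphere\<close>

lemma norm_diff_orthogonal:
  fixes a v :: "'a::real_inner"
  assumes "inner v a = (norm v)\<^sup>2"
  shows "(norm (a - v))\<^sup>2 = (norm a)\<^sup>2 - (norm v)\<^sup>2"
  using assms unfolding power2_norm_eq_inner inner_diff_left inner_diff_right
  by (simp add: inner_commute[of a v])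

text \<open>The hull lies in the ball of radius \<open>c\<close>, on which the functional
  \<open>inner v\<close> is at most \<open>c\<^sup>2\<close>, with equality only at \<open>v\<close>
  because then \<open>norm (a - v)\<close> vanishes. A unique maximizer of a linear functional
  cannot lie inside a segment.\<close>

lemma vertices_convex_hull_sphere:
  fixes S :: "'a::real_inner set"
  assumes nrm: "\<And>u. u \<in> S \<Longrightarrow> norm u = c"
  shows "vertices (convex hull S) = S"
proof
  show "vertices (convex hull S) \<subseteq> S"
    unfolding vertices_def using extreme_point_of_convex_hull by blast
next
  have ball: "norm x \<le> c" if "x \<in> convex hull S" for x
    using hull_minimal[of S "cball 0 c" convex] that nrm by (auto simp: subset_iff)
  have eq: "a = v" if "v \<in> S" "a \<in> convex hull S" "inner v a = c\<^sup>2" for a v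
  proof -
    have "(norm (a - v))\<^sup>2 = (norm a)\<^sup>2 - c\<^sup>2"
      using norm_diff_orthogonal[of v a] that(3) nrm[OF that(1)] by simp
    moreover have "(norm a)\<^sup>2 \<le> c\<^sup>2" using ball[OF that(2)] by (simp add: power_mono)
    ultimately have "(norm (a - v))\<^sup>2 \<le> 0" by linarith
    then show ?thesis by simp
  qed
  have le: "inner v a \<le> c\<^sup>2" if "v \<in> S" "a \<in> convex hull S" for a v
  proof -
    have "inner v a \<le> norm v * norm a" by (rule norm_cauchy_schwarz)
    also have "\<dots> \<le> c * c" using nrm[OF that(1)] ball[OF that(2)]
      by (metis mult_left_mono norm_ge_zero)
    finally show ?thesis by (simp add: power2_eq_square)
  qed
  show "S \<subseteq> vertices (convex hull S)"
  proof
    fix v assume v: "v \<in> S"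
    have "v \<notin> open_segment a b" if ab: "a \<in> convex hull S" "b \<in> convex hull S" for a b
    proof
      assume "v \<in> open_segment a b"
      then obtain u where u: "a \<noteq> b" "0 < u" "u < 1" "v = (1 - u) *\<^sub>R a + u *\<^sub>R b"
        by (auto simp: in_segment)
      have "(1 - u) * inner v a + u * inner v b = inner v v"
        using u(4) by (metis inner_add_right inner_scaleR_right)
      also have "\<dots> = c\<^sup>2" using nrm[OF v] by (metis power2_norm_eq_inner)
      finally have e: "(1 - u) * (c\<^sup>2 - inner v a) + u * (c\<^sup>2 - inner v b) = 0"
        by (simp add: algebra_simps)
      have "0 \<le> (1 - u) * (c\<^sup>2 - inner v a)" "0 \<le> u * (c\<^sup>2 - inner v b)"
        using le[OF v] ab u by auto
      then have "(1 - u) * (c\<^sup>2 - inner v a) = 0" "u * (c\<^sup>2 - inner v b) = 0"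
        using e by linarith+
      then have "a = v" "b = v" using u eq[OF v] ab by auto
      then show False using u(1) by simp
    qed
    then show "v \<in> vertices (convex hull S)"
      unfolding vertices_def extreme_point_of_def using hull_inc[OF v] by blast
  qed
qed

lemma ex_largest_subset:
  fixes g :: "'a \<Rightarrow> real"
  assumes "finite A" "k \<le> card A"
  shows "\<exists>F\<subseteq>A. card F = k \<and> (\<forall>i\<in>F. \<forall>j\<in>A - F. g j \<le> g i)"
  using assms(2)
proof (induction k)
  case 0
  show ?case by (intro exI[of _ "{}"]) auto
next
  case (Suc k)
  then obtain F where F: "F \<subseteq> A" "card F = k" "\<forall>i\<in>F. \<forall>j\<in>A - F. g j \<le> g i" by auto
  have finF: "finite F" using F(1) assms(1) finite_subset by blast
  have "A - F \<noteq> {}"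
    using F Suc.prems card_mono[OF finF, of A] by auto
  then obtain i where i: "i \<in> A - F" "\<forall>j\<in>A - F. g j \<le> g i"
    using ex_is_arg_min_if_finite[of "A - F" "\<lambda>i. - g i"] assms(1)
    by (auto simp: is_arg_min_linorder)
  show ?case
    using F i finF by (intro exI[of _ "insert i F"]) auto
qed

section \<open>Coordinate vectors\<close>

lift_definition unit_vec :: "nat \<Rightarrow> fvec" is "\<lambda>j i. if i = j then 1 else 0" by simp

lemma coord_unit_vec [simp]: "coord (unit_vec j) i = (if i = j then 1 else 0)"
  by transfer simp

lemma inner_unit_vec [simp]: "inner (unit_vec j) y = coord y j"
  by (subst inner_fvec_superset[of "{j}"]) auto

lemma inner_unit_vec' [simp]: "inner y (unit_vec j) = coord y j"
  by (subst inner_commute) simp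

lemma norm_unit_vec [simp]: "norm (unit_vec j) = 1"
  by (simp add: norm_eq_sqrt_inner)

text \<open>A homogeneous linear system with fewer equations (\<open>D\<close>) than unknowns (the
  coordinates in \<open>A\<close>) has a nonzero solution. The induction is Gaussian
  elimination.\<close>

lemma exists_orthogonal_supported:
  assumes "finite D" "card D \<le> t" "finite A" "t < card A"
  shows "\<exists>w. w \<noteq> 0 \<and> (\<forall>i. i \<notin> A \<longrightarrow> coord w i = 0) \<and> (\<forall>y\<in>D. inner w y = 0)"
  using assms
proof (induction t arbitrary: D A)
  case 0
  then obtain a where "a \<in> A" by fastforce
  then show ?case
    using 0 by (intro exI[of _ "unit_vec a"]) (auto dest: arg_cong[where f = "\<lambda>x. coord x a"])
next
  case (Suc t)
  show ?case
  proof (cases "\<exists>y\<in>D. \<exists>a\<in>A. coord y a \<noteq> 0")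
    case False
    obtain a where a: "a \<in> A" using Suc.prems by fastforce
    then show ?thesis
      using False by (intro exI[of _ "unit_vec a"]) (auto dest: arg_cong[where f = "\<lambda>x. coord x a"])
  next
    case True
    then obtain y a where ya: "y \<in> D" "a \<in> A" "coord y a \<noteq> 0" by blast
    \<comment> \<open>The pivot \<open>coord y a\<close> eliminates the unknown \<open>a\<close>
      from all other equations.\<close>
    define r where "r z = z - (coord z a / coord y a) *\<^sub>R y" for z
    have "card (r ` (D - {y})) \<le> card (D - {y})" using Suc.prems by (intro card_image_le) auto
    then have "card (r ` (D - {y})) \<le> t" using Suc.prems ya by auto
    moreover have "t < card (A - {a})" using Suc.prems ya by auto
    ultimately obtain w where w: "w \<noteq> 0" "\<forall>i. i \<notin> A - {a} \<longrightarrow> coord w i = 0"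
      "\<forall>z\<in>r ` (D - {y}). inner w z = 0"
      using Suc.IH[of "r ` (D - {y})" "A - {a}"] Suc.prems by auto
    \<comment> \<open>Back substitution: the coordinate at \<open>a\<close> is chosen to satisfy the
      pivot equation. The reduced equations do not involve this coordinate and stay
      satisfied.\<close>
    define w' where "w' = w - (inner w y / coord y a) *\<^sub>R unit_vec a"
    have "w' \<noteq> 0"
    proof
      assume w'0: "w' = 0"
      have "coord w i = 0" for i
        using w(2) arg_cong[OF w'0, of "\<lambda>x. coord x i"] by (cases "i = a") (auto simp: w'_def)
      then show False using w(1) by (auto intro: fvec_eqI)
    qed
    moreover have "\<forall>i. i \<notin> A \<longrightarrow> coord w' i = 0" using w(2) ya by (auto simp: w'_def)
    moreover have y0: "inner w' y = 0" using ya by (simp add: w'_def inner_diff_left)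
    moreover have "inner w' z = 0" if "z \<in> D" "z \<noteq> y" for z
    proof -
      have "inner w (r z) = 0" using w(3) that by auto
      moreover have "coord (r z) a = 0" using ya by (simp add: r_def)
      ultimately have "inner w' (r z) = 0" by (simp add: w'_def inner_diff_left)
      then show ?thesis using y0 by (simp add: r_def inner_diff_right)
    qed
    ultimately show ?thesis by blast
  qed
qed

section \<open>Runs of a method\<close>

lemma history_snoc:
  "history M P (h @ [x]) \<longleftrightarrow> history M P h \<and>
    ((\<exists>y. M h = Project y \<and> x = Point (projection P y)) \<or>
     (\<exists>w. M h = Evaluate w \<and> x = FirstOrder (objective P w) (subgrad P w)))"
  by (subst history.simps) auto

lemma history_length_unique:
  "history M P h \<Longrightarrow> history M P h' \<Longrightarrow> length h = length h' \<Longrightarrow> h = h'"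
proof (induction h arbitrary: h' rule: rev_induct)
  case Nil
  then show ?case by simp
next
  case (snoc x h)
  then obtain x' h'' where h': "h' = h'' @ [x']" by (cases h' rule: rev_cases) auto
  with snoc have "h = h''" by (auto simp: history_snoc)
  then show ?case using snoc.prems(1,2) unfolding h' history_snoc by auto
qed

lemma history_prefix:
  "history M P h \<Longrightarrow> n \<le> length h \<Longrightarrow> history M P (take n h)"
proof (induction h rule: rev_induct)
  case (snoc x h)
  then show ?case by (cases "n = length (h @ [x])") (auto simp: history_snoc)
qed simp

text \<open>Histories of a deterministic method are determined by their length, so a history longer
  than \<open>h'\<close> would have to continue after \<open>h'\<close>, where the method
  returns.\<close>

lemma history_comparable:
  assumes "history M P h" "outputs M P h' w"
  shows "length h \<le> length h'"
proof (rule ccontr)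
  assume "\<not> length h \<le> length h'"
  then have "length h' < length h" by simp
  then have "history M P (take (length h') h @ [h ! length h'])"
    using history_prefix[of M P h "Suc (length h')"] assms(1)
    by (simp add: take_Suc_conv_app_nth)
  moreover from this have "take (length h') h = h'"
    using assms(2) \<open>length h' < length h\<close> history_length_unique[of M P "take (length h') h" h']
    by (auto simp: outputs_def history_snoc)
  ultimately show False using assms(2) by (simp add: history_snoc outputs_def)
qed

lemma outputs_unique:
  assumes "outputs M P h w" "outputs M P h' w'"
  shows "h = h' \<and> w = w'"
proof -
  have "length h = length h'"
    using history_comparable assms by (meson le_antisym outputs_def)
  then have "h = h'" using assms history_length_unique by (auto simp: outputs_def)
  then show ?thesis using assms by (auto simp: outputs_def)
qed

text \<open>The instances still possible once the objective is public and the projection queries in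
  \<open>D\<close> have been answered by \<open>a\<close>. The feasible set is left open, so no
  first-order answer can tell two of them apart.\<close>

definition agrees :: "(fvec \<Rightarrow> real) \<Rightarrow> (fvec \<Rightarrow> fvec) \<Rightarrow> fvec set \<Rightarrow> (fvec \<Rightarrow> fvec) \<Rightarrow> problem \<Rightarrow> bool"
  where "agrees f s D a P \<longleftrightarrow> objective P = f \<and> subgrad P = s \<and> (\<forall>y\<in>D. projection P y = a y)"

text \<open>Until the first projection query outside \<open>D\<close>, the run is the same on all
  agreeing instances. Either this covers all of \<open>h\<close>, or \<open>h1\<close> is the common
  history at which that query is made. The counts of projection calls serve to bound the number of
  committed queries by the budget of the method.\<close>

lemma history_new_query:
  assumes P: "agrees f s D a P" and h0: "\<And>P'. agrees f s D a P' \<Longrightarrow> history M P' h0"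
    and h: "history M P h" "length h0 \<le> length h"
  shows "(\<forall>P'. agrees f s D a P' \<longrightarrow> history M P' h) \<and> projection_calls h0 \<le> projection_calls h \<or>
    (\<exists>h1 y. y \<notin> D \<and> M h1 = Project y \<and> (\<forall>P'. agrees f s D a P' \<longrightarrow> history M P' h1) \<and>
       projection_calls h0 \<le> projection_calls h1 \<and> projection_calls h1 < projection_calls h)"
  using h
proof (induction h rule: rev_induct)
  case Nil
  then show ?case using h0 by simp
next
  case (snoc x h)
  show ?case
  proof (cases "length h0 = length (h @ [x])")
    case True
    then have "h @ [x] = h0" using history_length_unique[OF snoc.prems(1) h0[OF P]] by simp
    then show ?thesis using h0 by auto
  next
    case False
    then have "length h0 \<le> length h" using snoc.prems by simp
    then have IH: "(\<forall>P'. agrees f s D a P' \<longrightarrow> history M P' h) \<and> projection_calls h0 \<le> projection_calls h \<or>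
      (\<exists>h1 y. y \<notin> D \<and> M h1 = Project y \<and> (\<forall>P'. agrees f s D a P' \<longrightarrow> history M P' h1) \<and>
         projection_calls h0 \<le> projection_calls h1 \<and> projection_calls h1 < projection_calls h)"
      using snoc by (simp add: history_snoc)
    have mono: "projection_calls h \<le> projection_calls (h @ [x])" by (simp add: projection_calls_def)
    from IH show ?thesis
    proof (elim disjE)
      assume A: "(\<forall>P'. agrees f s D a P' \<longrightarrow> history M P' h) \<and> projection_calls h0 \<le> projection_calls h"
      from snoc.prems(1) consider y where "M h = Project y" "x = Point (projection P y)"
        | w where "M h = Evaluate w" "x = FirstOrder (objective P w) (subgrad P w)"
        by (auto simp: history_snoc)
      then show ?thesis
      proof cases
        case 1
        show ?thesis
        proof (cases "y \<in> D")
          case True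
          then show ?thesis using A 1 P mono by (auto simp: history_snoc agrees_def)
        next
          case False
          moreover have "projection_calls h < projection_calls (h @ [x])"
            using 1 by (simp add: projection_calls_def)
          ultimately show ?thesis using A 1 by blast
        qed
      next
        case 2
        then show ?thesis using A P mono by (auto simp: history_snoc agrees_def)
      qed
    next
      assume "\<exists>h1 y. y \<notin> D \<and> M h1 = Project y \<and> (\<forall>P'. agrees f s D a P' \<longrightarrow> history M P' h1) \<and>
         projection_calls h0 \<le> projection_calls h1 \<and> projection_calls h1 < projection_calls h"
      then show ?thesis using mono less_le_trans by blast
    qed
  qed
qed

section \<open>The hard objective\<close>

locale hard_instance =
  fixes \<alpha> G :: real and N k :: nat
  assumes \<alpha>: "\<alpha> > 0" and G: "G > 0" and N: "N \<ge> 1" and k: "k \<ge> 1"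
begin

text \<open>The scale splits the subgradient bound: the l1 term contributes at most
  \<open>\<beta> * sqrt N = G / 2\<close>, and the quadratic term at most
  \<open>\<alpha> * c = \<beta> \<le> G / 2\<close> on the ball of radius \<open>c\<close>.\<close>

definition \<beta> :: real where "\<beta> = G / (2 * sqrt N)"

definition c :: real where "c = \<beta> / \<alpha>"

text \<open>A subgradient selection for the l1 norm of the first \<open>N\<close> coordinates: its
  inner product with \<open>w\<close> equals that norm of \<open>w\<close>, and with any other
  vector it is at most that norm of the vector.\<close>

definition sign_vec :: "fvec \<Rightarrow> fvec" where
  "sign_vec w = (\<Sum>i<N. sgn (coord w i) *\<^sub>R unit_vec i)"

definition f :: "fvec \<Rightarrow> real" where
  "f w = \<beta> * (\<Sum>i<N. \<bar>coord w i\<bar>) + \<alpha> / 2 * (norm w)\<^sup>2"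

definition s :: "fvec \<Rightarrow> fvec" where
  "s w = \<beta> *\<^sub>R sign_vec w + \<alpha> *\<^sub>R w"

lemma \<beta>_pos: "\<beta> > 0"
  using G N by (simp add: \<beta>_def)

lemma c_pos: "c > 0"
  using \<beta>_pos \<alpha> by (simp add: c_def)

lemma \<alpha>_c: "\<alpha> * c = \<beta>"
  using \<alpha> by (simp add: c_def)

lemma gap: "\<alpha> / 2 * c\<^sup>2 = G\<^sup>2 / (8 * \<alpha> * N)"
  using \<alpha> N by (simp add: c_def \<beta>_def power_divide power_mult_distrib field_simps power2_eq_square)

lemma G_bound: "\<beta> * sqrt N + \<alpha> * c \<le> G"
proof -
  have "\<beta> * 1 \<le> \<beta> * sqrt N" using N \<beta>_pos by (intro mult_left_mono) auto
  moreover have "\<beta> * sqrt N = G / 2" using N by (simp add: \<beta>_def)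
  ultimately show ?thesis using \<alpha>_c by simp
qed

lemma coord_sign_vec: "coord (sign_vec w) i = (if i < N then sgn (coord w i) else 0)"
  by (simp add: sign_vec_def if_distrib[of "\<lambda>x. _ * x"] sum.delta cong: if_cong)

lemma inner_sign_vec: "inner (sign_vec w) y = (\<Sum>i<N. sgn (coord w i) * coord y i)"
  by (simp add: sign_vec_def inner_sum_left)

lemma inner_sign_vec_self: "inner (sign_vec w) w = (\<Sum>i<N. \<bar>coord w i\<bar>)"
  unfolding inner_sign_vec by (intro sum.cong) (auto simp: abs_sgn mult.commute)

lemma inner_sign_vec_le: "inner (sign_vec w) y \<le> (\<Sum>i<N. \<bar>coord y i\<bar>)"
  unfolding inner_sign_vec by (intro sum_mono) (auto simp: sgn_if)

lemma norm_sign_vec: "norm (sign_vec w) \<le> sqrt N"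
proof -
  have "inner (sign_vec w) (sign_vec w) = (\<Sum>i<N. sgn (coord w i) * sgn (coord w i))"
    by (simp add: inner_sign_vec coord_sign_vec)
  also have "\<dots> \<le> (\<Sum>i<N. 1)" by (intro sum_mono) (auto simp: sgn_if)
  finally show ?thesis by (simp add: norm_eq_sqrt_inner)
qed

lemma strongly_convex_f: "strongly_convex_on (Rn n) \<alpha> f"
  unfolding strongly_convex_on_def
proof (intro conjI ballI allI impI)
  show "convex (Rn n)" using subspace_Rn by (rule subspace_imp_convex)
next
  fix x y and u v :: real
  assume uv: "0 \<le> u" "0 \<le> v" "u + v = 1"
  have "(\<Sum>i<N. \<bar>coord (u *\<^sub>R x + v *\<^sub>R y) i\<bar>) \<le> (\<Sum>i<N. u * \<bar>coord x i\<bar> + v * \<bar>coord y i\<bar>)"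
    using uv by (intro sum_mono) (auto simp: abs_mult intro!: order_trans[OF abs_triangle_ineq])
  then have "\<beta> * (\<Sum>i<N. \<bar>coord (u *\<^sub>R x + v *\<^sub>R y) i\<bar>) \<le>
      \<beta> * (u * (\<Sum>i<N. \<bar>coord x i\<bar>) + v * (\<Sum>i<N. \<bar>coord y i\<bar>))"
    using \<beta>_pos by (intro mult_left_mono) (simp_all add: sum.distrib sum_distrib_left)
  moreover have norm2: "(norm (u *\<^sub>R x + v *\<^sub>R y))\<^sup>2 = u * (norm x)\<^sup>2 + v * (norm y)\<^sup>2 - u * v * (norm (x - y))\<^sup>2"
  proof -
    have "v = 1 - u" using uv by simp
    then show ?thesis
      unfolding power2_norm_eq_inner \<open>v = 1 - u\<close>
      by (simp add: inner_add_left inner_add_right inner_diff_left inner_diff_right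
          inner_commute[of y x] algebra_simps)
  qed
  ultimately show "f (u *\<^sub>R x + v *\<^sub>R y) \<le> u * f x + v * f y - \<alpha> / 2 * u * v * (norm (x - y))\<^sup>2"
    unfolding f_def norm2 by (simp add: algebra_simps)
qed

lemma s_subdifferential:
  assumes "N \<le> n" "w \<in> Rn n"
  shows "s w \<in> subdifferential (Rn n) f w"
proof -
  have "sign_vec w \<in> Rn n" using assms by (auto simp: Rn_def coord_sign_vec)
  then have "s w \<in> Rn n" using assms(2) unfolding s_def Rn_def by auto
  moreover have "f y \<ge> f w + inner (s w) (y - w)" for y
  proof -
    have "\<beta> * inner (sign_vec w) y \<le> \<beta> * (\<Sum>i<N. \<bar>coord y i\<bar>)"
      using inner_sign_vec_le \<beta>_pos by simp
    moreover have "\<alpha> / 2 * ((norm w)\<^sup>2 + 2 * inner w (y - w)) \<le> \<alpha> / 2 * (norm y)\<^sup>2"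
    proof (intro mult_left_mono)
      have "0 \<le> (norm (y - w))\<^sup>2" by simp
      then show "(norm w)\<^sup>2 + 2 * inner w (y - w) \<le> (norm y)\<^sup>2"
        unfolding power2_norm_eq_inner
        by (simp add: inner_diff_left inner_diff_right inner_commute[of y w])
    qed (use \<alpha> in simp)
    ultimately show ?thesis
      unfolding f_def s_def inner_sign_vec_self[symmetric]
      by (simp add: inner_add_left inner_diff_right algebra_simps)
  qed
  ultimately show ?thesis by (simp add: subdifferential_def)
qed

text \<open>The bound must hold for every subgradient, not just for \<open>s w\<close>. Along the
  direction \<open>g\<close> itself, the subgradient inequality forces growth
  \<open>t * (norm g)\<^sup>2\<close>, while \<open>f\<close> grows at most by
  \<open>t * norm g\<close> times the claimed bound plus a term of second order in
  \<open>t\<close>.\<close>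

lemma norm_subdifferential:
  assumes w: "w \<in> Rn n" and g: "g \<in> subdifferential (Rn n) f w"
  shows "norm g \<le> \<beta> * sqrt N + \<alpha> * norm w"
proof (rule ccontr)
  let ?B = "\<beta> * sqrt N + \<alpha> * norm w"
  assume "\<not> norm g \<le> ?B"
  then have B: "?B < norm g" by simp
  have B0: "0 \<le> ?B" using \<beta>_pos \<alpha> by simp
  have gpos: "norm g > 0" using B B0 by linarith
  \<comment> \<open>This step size makes the second-order contribution exactly half of the excess
    \<open>norm g - ?B\<close>, too little to account for it.\<close>
  define t where "t = (norm g - ?B) / (\<alpha> * norm g)"
  have t: "t > 0" using B \<alpha> gpos by (simp add: t_def)
  define x where "x = w + t *\<^sub>R g"
  have "x \<in> Rn n"
    using w g by (auto simp: x_def Rn_def subdifferential_def)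
  then have "f w + inner g (x - w) \<le> f x" using g by (simp add: subdifferential_def)
  then have 1: "f w + t * (norm g)\<^sup>2 \<le> f x" by (simp add: x_def power2_norm_eq_inner)
  have "inner (sign_vec x) g \<le> norm (sign_vec x) * norm g" by (rule norm_cauchy_schwarz)
  also have "\<dots> \<le> sqrt N * norm g" using norm_sign_vec by (intro mult_right_mono) auto
  finally have "t * inner (sign_vec x) g \<le> t * (sqrt N * norm g)" using t by simp
  moreover have "(\<Sum>i<N. \<bar>coord x i\<bar>) = inner (sign_vec x) w + t * inner (sign_vec x) g"
    unfolding inner_sign_vec_self[symmetric] by (simp add: x_def inner_add_right)
  ultimately have "(\<Sum>i<N. \<bar>coord x i\<bar>) \<le> (\<Sum>i<N. \<bar>coord w i\<bar>) + t * (sqrt N * norm g)"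
    using inner_sign_vec_le[of x w] by linarith
  then have 2: "\<beta> * (\<Sum>i<N. \<bar>coord x i\<bar>) \<le> \<beta> * ((\<Sum>i<N. \<bar>coord w i\<bar>) + t * (sqrt N * norm g))"
    using \<beta>_pos by simp
  have "(norm x)\<^sup>2 = (norm w)\<^sup>2 + 2 * t * inner w g + t\<^sup>2 * (norm g)\<^sup>2"
    unfolding power2_norm_eq_inner x_def
    by (simp add: inner_add_left inner_add_right inner_commute[of g w] power2_eq_square algebra_simps)
  also have "\<dots> \<le> (norm w)\<^sup>2 + 2 * t * (norm w * norm g) + t\<^sup>2 * (norm g)\<^sup>2"
    using norm_cauchy_schwarz[of w g] t by simp
  finally have 3: "\<alpha> / 2 * (norm x)\<^sup>2 \<le>
      \<alpha> / 2 * ((norm w)\<^sup>2 + 2 * t * (norm w * norm g) + t\<^sup>2 * (norm g)\<^sup>2)"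
    using \<alpha> by simp
  have "t * norm g * norm g \<le> t * norm g * (?B + \<alpha> / 2 * t * norm g)"
    using 1 2 3 unfolding f_def by (simp add: algebra_simps power2_eq_square)
  then have "norm g \<le> ?B + \<alpha> / 2 * t * norm g" using t gpos by simp
  moreover have "\<alpha> / 2 * t * norm g = (norm g - ?B) / 2" using \<alpha> gpos by (simp add: t_def)
  ultimately show False using B by simp
qed

section \<open>States of the adversary: extension, completion and play against a method\<close>

definition vert :: "(nat \<Rightarrow> real) \<Rightarrow> nat \<Rightarrow> fvec" where
  "vert \<sigma> j = (c * \<sigma> j) *\<^sub>R unit_vec j"

lemma norm_vert: "\<bar>\<sigma> j\<bar> = 1 \<Longrightarrow> norm (vert \<sigma> j) = c"
  using c_pos by (simp add: vert_def abs_mult)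

lemma inner_vert_vert: "i \<noteq> j \<Longrightarrow> inner (vert \<sigma> i) (vert \<tau> j) = 0"
  by (simp add: vert_def)

lemma vert_image_orthogonal:
  "u \<in> vert \<sigma> ` J \<Longrightarrow> v \<in> vert \<sigma> ` J \<Longrightarrow> u \<noteq> v \<Longrightarrow> inner u v = 0"
  by (auto intro!: inner_vert_vert)

text \<open>The answer to \<open>y\<close> survives adding vertices orthogonal to \<open>y\<close> (first condition) and vertices
  on coordinates outside \<open>J\<close> of either sign (second condition).\<close>

definition robust :: "fvec \<Rightarrow> nat set \<Rightarrow> (nat \<Rightarrow> real) \<Rightarrow> bool" where
  "robust y J \<sigma> \<longleftrightarrow> (\<exists>F\<subseteq>J. card F = k \<and> (\<forall>i\<in>F. 0 \<le> \<sigma> i * coord y i \<and>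
     (\<forall>j\<in>{..<N} - J. \<bar>coord y j\<bar> \<le> \<sigma> i * coord y i)))"

text \<open>The state of the adversary: answered queries \<open>D\<close> with answers
  \<open>a\<close>, and committed coordinates \<open>J\<close> with signs \<open>\<sigma>\<close>.
  Signs outside \<open>J\<close> are not committed yet and may be changed later.\<close>

definition consistent :: "fvec set \<Rightarrow> (fvec \<Rightarrow> fvec) \<Rightarrow> nat set \<Rightarrow> (nat \<Rightarrow> real) \<Rightarrow> bool" where
  "consistent D a J \<sigma> \<longleftrightarrow> finite D \<and> J \<subseteq> {..<N} \<and> (\<forall>j. \<bar>\<sigma> j\<bar> = 1) \<and>
     (\<forall>y\<in>D. robust y J \<sigma> \<and>
        is_arg_min (\<lambda>z. norm (z - y)) (\<lambda>z. z \<in> sparse_hull k (vert \<sigma> ` J)) (a y))"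

lemma inj_vert: "(\<forall>j. \<bar>\<sigma> j\<bar> = 1) \<Longrightarrow> inj (vert \<sigma>)"
proof (rule injI, rule ccontr)
  fix i j assume *: "\<forall>j. \<bar>\<sigma> j\<bar> = 1" "vert \<sigma> i = vert \<sigma> j" "i \<noteq> j"
  then have "inner (vert \<sigma> i) (vert \<sigma> i) = 0" using inner_vert_vert[of i j \<sigma> \<sigma>] by simp
  then show False using norm_vert[of \<sigma> i] *(1) c_pos by simp
qed

lemma consistent_extend:
  assumes cons: "consistent D a J \<sigma>" and y: "y \<notin> D" and room: "card J + k \<le> N"
  obtains b J' \<sigma>' where "consistent (insert y D) (a(y := b)) J' \<sigma>'" "card J' \<le> card J + k"
proof -
  have D: "finite D" and J: "J \<subseteq> {..<N}" and sg: "\<And>j. \<bar>\<sigma> j\<bar> = 1"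
    using cons by (auto simp: consistent_def)
  have finJ: "finite J" using J finite_subset by blast
  \<comment> \<open>The fresh coordinates \<open>F\<close> are the \<open>k\<close> free ones with
    largest absolute value in \<open>y\<close>. Giving them the signs of \<open>y\<close> makes each
    \<open>vert \<sigma>' i\<close> with \<open>i \<in> F\<close> at least as aligned with
    \<open>y\<close> as any vertex that can still be added.\<close>
  have "k \<le> card ({..<N} - J)" using room J finJ by (simp add: card_Diff_subset)
  then obtain F where F: "F \<subseteq> {..<N} - J" "card F = k"
    "\<forall>i\<in>F. \<forall>j\<in>({..<N} - J) - F. \<bar>coord y j\<bar> \<le> \<bar>coord y i\<bar>"
    using ex_largest_subset[of "{..<N} - J" k "\<lambda>i. \<bar>coord y i\<bar>"] by auto
  have finF: "finite F" using F(1) finite_subset by blast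
  define J' where "J' = J \<union> F"
  define \<sigma>' where "\<sigma>' j = (if j \<in> J then \<sigma> j else if coord y j \<ge> 0 then 1 else - 1)" for j
  have sg': "\<bar>\<sigma>' j\<bar> = 1" for j using sg by (simp add: \<sigma>'_def)
  have J': "J' \<subseteq> {..<N}" "finite J'" using J F finF finJ by (auto simp: J'_def)
  have VJ: "vert \<sigma>' ` J = vert \<sigma> ` J" by (rule image_cong) (auto simp: vert_def \<sigma>'_def)
  have "F \<noteq> {}" using F(2) k by auto
  then obtain b where b:
    "is_arg_min (\<lambda>z. norm (z - y)) (\<lambda>z. z \<in> sparse_hull k (vert \<sigma>' ` J')) b"
    using sparse_hull_arg_min_exists[of "vert \<sigma>' ` J'" k y] J' k by (auto simp: J'_def)
  have "\<sigma>' i * coord y i = \<bar>coord y i\<bar>" if "i \<in> F" for i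
    using that F(1) by (auto simp: \<sigma>'_def)
  then have rob_y: "robust y J' \<sigma>'"
    unfolding robust_def using F by (intro exI[of _ F]) (auto simp: J'_def)
  have old: "robust x J' \<sigma>' \<and>
      is_arg_min (\<lambda>z. norm (z - x)) (\<lambda>z. z \<in> sparse_hull k (vert \<sigma>' ` J')) (a x)" if x: "x \<in> D" for x
  proof -
    obtain E where E: "E \<subseteq> J" "card E = k" "\<forall>i\<in>E. 0 \<le> \<sigma> i * coord x i \<and>
        (\<forall>j\<in>{..<N} - J. \<bar>coord x j\<bar> \<le> \<sigma> i * coord x i)"
      using cons x unfolding consistent_def robust_def by blast
    have E': "\<forall>i\<in>E. \<sigma>' i = \<sigma> i" using E(1) by (auto simp: \<sigma>'_def)
    have "robust x J' \<sigma>'"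
      unfolding robust_def using E E' by (intro exI[of _ E]) (auto simp: J'_def)
    moreover have "is_arg_min (\<lambda>z. norm (z - x)) (\<lambda>z. z \<in> sparse_hull k (vert \<sigma>' ` J')) (a x)"
    proof (rule sparse_hull_arg_min_extend[where V = "vert \<sigma> ` J" and F = "vert \<sigma> ` E" and c = c])
      show "finite (vert \<sigma>' ` J')" using J' by simp
      show "vert \<sigma> ` J \<subseteq> vert \<sigma>' ` J'" using VJ by (auto simp: J'_def)
      show "vert \<sigma> ` E \<subseteq> vert \<sigma> ` J" using E by auto
      show "k \<le> card (vert \<sigma> ` E)"
        using E inj_vert[of \<sigma>] sg by (simp add: card_image inj_on_subset)
      show "norm u = c" if "u \<in> vert \<sigma>' ` J'" for u using that sg' norm_vert by auto
      show "inner u v = 0" if "u \<in> vert \<sigma>' ` J'" "v \<in> vert \<sigma>' ` J'" "u \<noteq> v" for u v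
        using that by (rule vert_image_orthogonal)
      show "inner u x \<le> inner v x" if uv: "u \<in> vert \<sigma>' ` J' - vert \<sigma> ` J" "v \<in> vert \<sigma> ` E" for u v
      proof -
        obtain j where j: "j \<in> J'" "u = vert \<sigma>' j" "j \<notin> J" using uv(1) VJ by auto
        obtain i where i: "i \<in> E" "v = vert \<sigma> i" using uv(2) by auto
        \<comment> \<open>The sign of a fresh vertex was dictated by the new query and is arbitrary
          for the old query \<open>x\<close>; robustness of \<open>x\<close> covers both
          signs.\<close>
        have "\<sigma>' j * coord x j \<le> \<bar>coord x j\<bar>" 
          using j(3) by (auto simp: \<sigma>'_def abs_ge_self abs_ge_minus_self)
        also have "\<dots> \<le> \<sigma> i * coord x i" using E(3) i j J' by auto
        finally show ?thesis using i j c_pos by (simp add: vert_def mult.assoc)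
      qed
      show "is_arg_min (\<lambda>z. norm (z - x)) (\<lambda>z. z \<in> sparse_hull k (vert \<sigma> ` J)) (a x)"
        using cons x by (auto simp: consistent_def)
    qed
    ultimately show ?thesis ..
  qed
  have "consistent (insert y D) (a(y := b)) J' \<sigma>'"
    unfolding consistent_def using D J' sg' old rob_y b y by auto
  moreover have "card J' \<le> card J + k"
    unfolding J'_def using card_Un_le[of J F] F(2) by simp
  ultimately show ?thesis using that by blast
qed

text \<open>Adding one hidden vertex \<open>v\<close> turns a state into a full instance. It must be
  orthogonal to all of \<open>D\<close> and to \<open>x\<close>, which is at most
  \<open>card D + 1\<close> conditions on the \<open>5 * N\<close> coordinates from \<open>N\<close>
  on. The point \<open>x\<close> stands for the output of the method.\<close>

lemma complete_instance:
  assumes cons: "consistent D a J \<sigma>" and room: "card D + 1 < 5 * N"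
  obtains P wstar where "admissible \<alpha> G (6 * N) k P" "agrees f s D a P"
    "wstar \<in> vertices (feasible P)" "unique_minimizer P wstar"
    "x \<in> feasible P \<Longrightarrow> objective P x - objective P wstar \<ge> \<alpha> / 2 * c\<^sup>2"
proof -
  have D: "finite D" and J: "J \<subseteq> {..<N}" and sg: "\<And>j. \<bar>\<sigma> j\<bar> = 1"
    using cons by (auto simp: consistent_def)
  have finJ: "finite J" using J finite_subset by blast
  have "card (insert x D) \<le> card D + 1" using D by (simp add: card_insert_if)
  then obtain u where u: "u \<noteq> 0" "\<forall>i. i \<notin> {N..<6 * N} \<longrightarrow> coord u i = 0"
    "\<forall>y\<in>insert x D. inner u y = 0"
    using exists_orthogonal_supported[of "insert x D" "card D + 1" "{N..<6 * N}"] D room by force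
  define v where "v = (c / norm u) *\<^sub>R u"
  have v_norm: "norm v = c" using u c_pos by (simp add: v_def)
  have v_coord: "coord v i = 0" if "i \<notin> {N..<6 * N}" for i using u that by (simp add: v_def)
  have v_D: "inner v y = 0" if "y \<in> insert x D" for y using u that by (auto simp: v_def)
  define W where "W = insert v (vert \<sigma> ` J)"
  define K where "K = convex hull W"
  have finW: "finite W" using finJ by (simp add: W_def)
  have v_vert: "inner v (vert \<tau> j) = 0" if "j < N" for j \<tau>
    using v_coord[of j] that by (simp add: vert_def)
  have W_norm: "norm w = c" if "w \<in> W" for w
    using that v_norm norm_vert sg by (auto simp: W_def)
  have W_orth: "inner w w' = 0" if w: "w \<in> W" "w' \<in> W" "w \<noteq> w'" for w w'
  proof -
    have "inner v z = 0" if "z \<in> vert \<sigma> ` J" for z using that v_vert J by auto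
    moreover have "inner z v = 0" if "z \<in> vert \<sigma> ` J" for z
      using that v_vert J by (subst inner_commute) auto
    ultimately show ?thesis
      using w vert_image_orthogonal[of w \<sigma> J w'] unfolding W_def by blast
  qed
  have vertices_K: "vertices K = W"
    unfolding K_def by (rule vertices_convex_hull_sphere[OF W_norm])
  have "W \<subseteq> Rn (6 * N)"
    using v_coord J unfolding W_def Rn_def vert_def by force
  then have K_Rn: "K \<subseteq> Rn (6 * N)"
    unfolding K_def by (intro hull_minimal subspace_imp_convex subspace_Rn)
  have K_norm: "norm z \<le> c" if "z \<in> K" for z
    using hull_minimal[of W "cball 0 c" convex] that W_norm by (auto simp: K_def subset_iff)
  have f_v: "f v = \<alpha> / 2 * c\<^sup>2" using v_norm v_coord by (simp add: f_def)
  \<comment> \<open>One estimate serves twice: the right-hand side is positive unless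
    \<open>z = v\<close>, giving uniqueness of the minimizer, and equals the full gap when
    \<open>z\<close> is orthogonal to \<open>v\<close>.\<close>
  have lower: "f z - f v \<ge> \<alpha> / 2 * (c - inner z v / c)\<^sup>2" if z: "z \<in> K" for z
  proof -
    \<comment> \<open>The sum of all vertices has inner product \<open>c\<^sup>2\<close> with each
      of them, so \<open>K\<close> lies in a hyperplane. On it, whatever \<open>inner z v\<close>
      lacks to \<open>c\<^sup>2\<close> is made up by the first \<open>N\<close> coordinates and
      hence paid for in the l1 term.\<close>
    define q where "q = v + (\<Sum>j\<in>J. vert \<sigma> j)"
    have "inner q w = c\<^sup>2" if w: "w \<in> W" for w
    proof (cases "w = v")
      case True
      have "inner (\<Sum>j\<in>J. vert \<sigma> j) v = 0"
        unfolding inner_sum_left using v_vert J by (intro sum.neutral) (auto simp: inner_commute[of _ v])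
      then show ?thesis
        using True v_norm by (simp add: q_def inner_add_left flip: power2_norm_eq_inner)
    next
      case False
      then obtain i where i: "i \<in> J" "w = vert \<sigma> i" using w by (auto simp: W_def)
      have "inner (\<Sum>j\<in>J. vert \<sigma> j) w = (\<Sum>j\<in>J. if j = i then c\<^sup>2 else 0)"
        unfolding inner_sum_left i(2)
        using norm_vert[of \<sigma> i] sg inner_vert_vert
        by (intro sum.cong) (auto simp flip: power2_norm_eq_inner)
      also have "\<dots> = c\<^sup>2" using i finJ by simp
      finally show ?thesis using v_vert[of i \<sigma>] i J by (auto simp: q_def inner_add_left)
    qed
    then have "K \<subseteq> {z. inner q z = c\<^sup>2}"
      unfolding K_def by (intro hull_minimal convex_hyperplane) auto
    then have "inner q z = c\<^sup>2" using z by auto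
    then have "c\<^sup>2 - inner z v = c * (\<Sum>j\<in>J. \<sigma> j * coord z j)"
      by (simp add: q_def inner_add_left inner_sum_left vert_def inner_commute[of z v]
          sum_distrib_left mult.assoc)
    also have "\<dots> \<le> c * (\<Sum>j<N. \<bar>coord z j\<bar>)"
    proof (intro mult_left_mono)
      have "(\<Sum>j\<in>J. \<sigma> j * coord z j) \<le> (\<Sum>j\<in>J. \<bar>coord z j\<bar>)"
        using sg by (intro sum_mono) (metis abs_ge_self abs_mult mult_1)
      also have "\<dots> \<le> (\<Sum>j<N. \<bar>coord z j\<bar>)" using J by (intro sum_mono2) auto
      finally show "(\<Sum>j\<in>J. \<sigma> j * coord z j) \<le> (\<Sum>j<N. \<bar>coord z j\<bar>)" .
    qed (use c_pos in simp)
    finally have "\<alpha> * (c\<^sup>2 - inner z v) \<le> \<alpha> * (c * (\<Sum>j<N. \<bar>coord z j\<bar>))" using \<alpha> by simp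
    also have "\<dots> = \<beta> * (\<Sum>j<N. \<bar>coord z j\<bar>)" using \<alpha>_c by (simp flip: mult.assoc)
    finally have 1: "\<alpha> * (c\<^sup>2 - inner z v) \<le> \<beta> * (\<Sum>j<N. \<bar>coord z j\<bar>)" .
    \<comment> \<open>The quadratic term is bounded below by the component of \<open>z\<close> along
      \<open>v\<close>; together with the l1 estimate this completes the square.\<close>
    have "\<bar>inner z v\<bar> \<le> norm z * c" using Cauchy_Schwarz_ineq2[of z v] v_norm by simp
    then have "\<bar>inner z v / c\<bar> \<le> \<bar>norm z\<bar>" using c_pos by (simp add: field_simps)
    then have "(inner z v / c)\<^sup>2 \<le> (norm z)\<^sup>2" by (simp only: abs_le_square_iff)
    then have "\<alpha> / 2 * (inner z v / c)\<^sup>2 \<le> \<alpha> / 2 * (norm z)\<^sup>2" using \<alpha> by simp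
    moreover have "\<alpha> / 2 * (c - inner z v / c)\<^sup>2 =
        \<alpha> * (c\<^sup>2 - inner z v) + \<alpha> / 2 * (inner z v / c)\<^sup>2 - \<alpha> / 2 * c\<^sup>2"
      using c_pos by (simp add: power2_diff field_simps power2_eq_square)
    ultimately show ?thesis using 1 f_v by (simp add: f_def)
  qed
  have v_K: "v \<in> K" by (simp add: K_def W_def hull_inc)
  have less: "f v < f z" if z: "z \<in> K" "z \<noteq> v" for z
  proof -
    have "c - inner z v / c \<noteq> 0"
    proof
      assume "c - inner z v / c = 0"
      then have "inner z v = c\<^sup>2" using c_pos by (simp add: field_simps power2_eq_square)
      then have "(norm (z - v))\<^sup>2 = (norm z)\<^sup>2 - c\<^sup>2"
        using norm_diff_orthogonal[of v z] v_norm by (simp add: inner_commute)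
      also have "\<dots> \<le> 0" using K_norm[OF z(1)] by (simp add: power_mono)
      finally show False using z(2) by simp
    qed
    then have "0 < \<alpha> / 2 * (c - inner z v / c)\<^sup>2" using \<alpha> by simp
    then show ?thesis using lower[OF z(1)] by linarith
  qed
  \<comment> \<open>Queries already made keep their committed answers; all others get an arbitrary
    fixed nearest point.\<close>
  define proj where "proj y = (if y \<in> D then a y else
    (SOME z. is_arg_min (\<lambda>z. norm (z - y)) (\<lambda>z. z \<in> sparse_hull k W) z))" for y
  define P where "P = \<lparr>feasible = K, objective = f, projection = proj, subgrad = s\<rparr>"
  have proj: "is_arg_min (\<lambda>z. norm (z - y)) (\<lambda>z. z \<in> sparse_hull k W) (proj y)" for y
  proof (cases "y \<in> D")
    case False
    have "W \<noteq> {}" by (simp add: W_def)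
    then show ?thesis
      using False someI_ex[OF sparse_hull_arg_min_exists[OF finW _ k, of y]] by (simp add: proj_def)
  next
    case True
    then obtain E where E: "E \<subseteq> J" "card E = k" "\<forall>i\<in>E. 0 \<le> \<sigma> i * coord y i"
      using cons unfolding consistent_def robust_def by blast
    have "is_arg_min (\<lambda>z. norm (z - y)) (\<lambda>z. z \<in> sparse_hull k W) (a y)"
    proof (rule sparse_hull_arg_min_extend[where V = "vert \<sigma> ` J" and F = "vert \<sigma> ` E" and c = c])
      show "k \<le> card (vert \<sigma> ` E)"
        using E inj_vert[of \<sigma>] sg by (simp add: card_image inj_on_subset)
      show "inner z y \<le> inner w y" if "z \<in> W - vert \<sigma> ` J" "w \<in> vert \<sigma> ` E" for z w
      proof -
        \<comment> \<open>The only new vertex is \<open>v\<close>, orthogonal to \<open>y\<close>,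
          while the vertices from \<open>E\<close> have nonnegative inner product with
          \<open>y\<close>.\<close>
        have "inner z y = 0" using that v_D True by (auto simp: W_def)
        then show ?thesis using that(2) E(3) c_pos by (auto simp: vert_def mult.assoc)
      qed
      show "is_arg_min (\<lambda>z. norm (z - y)) (\<lambda>z. z \<in> sparse_hull k (vert \<sigma> ` J)) (a y)"
        using cons True by (auto simp: consistent_def)
    qed (use finW E W_norm W_orth in \<open>auto simp: W_def\<close>)
    then show ?thesis using True by (simp add: proj_def)
  qed
  have min: "unique_minimizer P v"
  proof -
    have "is_arg_min f (\<lambda>x. x \<in> K) z \<longleftrightarrow> z = v" for z
      using less v_K unfolding is_arg_min_def by (metis less_asym)
    then show ?thesis by (simp add: unique_minimizer_def P_def)
  qed
  show ?thesis
  proof (rule that[of P v])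
    have "norm g \<le> G" if w: "w \<in> K" "g \<in> subdifferential (Rn (6 * N)) f w" for w g
    proof -
      have "norm g \<le> \<beta> * sqrt N + \<alpha> * norm w" using w K_Rn by (intro norm_subdifferential) auto
      also have "\<dots> \<le> \<beta> * sqrt N + \<alpha> * c" using K_norm[OF w(1)] \<alpha> by simp
      finally show ?thesis using G_bound by linarith
    qed
    then show "admissible \<alpha> G (6 * N) k P"
      using K_Rn finite_imp_compact_convex_hull[OF finW] vertices_K strongly_convex_f min proj
        s_subdifferential
      unfolding admissible_def by (auto simp: P_def K_def W_def)
    show "agrees f s D a P" by (simp add: agrees_def P_def proj_def)
    show "v \<in> vertices (feasible P)" using vertices_K by (simp add: P_def W_def)
    show "objective P x - objective P v \<ge> \<alpha> / 2 * c\<^sup>2" if "x \<in> feasible P"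
      using that lower[of x] v_D[of x] by (simp add: P_def inner_commute[of x v])
  qed (use min in simp_all)
qed

text \<open>Induction on the remaining budget \<open>T - card D\<close>. The method is run on some
  completion of the current state. Either its whole run is common to all agreeing instances, so the
  output is already determined, or its first new query is answered by committing at most
  \<open>k\<close> more vertices.\<close>

lemma adversary_step:
  assumes terminates: "\<And>P. admissible \<alpha> G (6 * N) k P \<Longrightarrow>
      \<exists>h w. outputs M P h w \<and> projection_calls h \<le> T"
    and T: "k * T \<le> N" "T + 1 < 5 * N"
    and state: "consistent D a J \<sigma>" "card J \<le> k * card D" "card D \<le> T"
    and h0: "\<And>P. agrees f s D a P \<Longrightarrow> history M P h0" "card D \<le> projection_calls h0"
  shows "\<exists>D a J \<sigma> h w. consistent D a J \<sigma> \<and> card D \<le> T \<and>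
    (\<forall>P. agrees f s D a P \<longrightarrow> outputs M P h w)"
  using state h0
proof (induction "T - card D" arbitrary: D a J \<sigma> h0 rule: less_induct)
  case less
  have finD: "finite D" using less.prems(1) by (simp add: consistent_def)
  \<comment> \<open>This instance only serves to find the next query, so the vector \<open>0\<close>
    is passed for the output, which is not known yet.\<close>
  obtain P wstar where P: "admissible \<alpha> G (6 * N) k P" "agrees f s D a P"
    using complete_instance[OF less.prems(1), where x = 0] less.prems(3) T(2) by auto
  obtain h w where h: "outputs M P h w" "projection_calls h \<le> T" using terminates[OF P(1)] by blast
  have "length h0 \<le> length h" using history_comparable[OF less.prems(4)[OF P(2)] h(1)] .
  then consider "\<forall>P'. agrees f s D a P' \<longrightarrow> history M P' h"
    | h1 y where "y \<notin> D" "M h1 = Project y" "\<forall>P'. agrees f s D a P' \<longrightarrow> history M P' h1"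
      "projection_calls h0 \<le> projection_calls h1" "projection_calls h1 < projection_calls h"
    using history_new_query[OF P(2) less.prems(4), where h = h] h(1) unfolding outputs_def by blast
  then show ?case
  proof cases
    case 1
    then show ?thesis using less.prems(1,3) h(1) unfolding outputs_def by blast
  next
    case 2
    \<comment> \<open>At least \<open>card D\<close> calls precede the new query, and the new query
      is itself a call within the budget \<open>T\<close>.\<close>
    have lt: "card D < T" using 2 h(2) less.prems(5) by linarith
    have "card J + k \<le> k * (card D + 1)" using less.prems(2) by simp
    also have "\<dots> \<le> k * T" using lt by (intro mult_left_mono) auto
    finally have "card J + k \<le> N" using T(1) by linarith
    then obtain b J' \<sigma>' where ext: "consistent (insert y D) (a(y := b)) J' \<sigma>'" "card J' \<le> card J + k"
      using consistent_extend[OF less.prems(1) 2(1)] by metis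
    show ?thesis
    proof (rule less.hyps[OF _ ext(1), of "h1 @ [Point b]"])
      show "T - card (insert y D) < T - card D" using lt 2(1) finD by simp
      show "card J' \<le> k * card (insert y D)" using ext(2) less.prems(2) 2(1) finD by simp
      show "card (insert y D) \<le> T" using lt 2(1) finD by simp
      show "card (insert y D) \<le> projection_calls (h1 @ [Point b])"
        using 2(1,4) finD less.prems(5) by (simp add: projection_calls_def)
      show "history M P' (h1 @ [Point b])" if "agrees f s (insert y D) (a(y := b)) P'" for P'
      proof -
        have "agrees f s D a P'" "projection P' y = b"
          using that 2(1) by (auto simp: agrees_def split: if_splits)
        then show ?thesis using 2(2,3) by (simp add: history_snoc)
      qed
    qed
  qed
qed

lemma lower_bound:
  assumes terminates: "\<And>P. admissible \<alpha> G (6 * N) k P \<Longrightarrow>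
      \<exists>h w. outputs M P h w \<and> projection_calls h \<le> N div (4 * k)"
  shows "\<exists>P wstar h w. admissible \<alpha> G (6 * N) k P \<and>
    wstar \<in> vertices (feasible P) \<and> unique_minimizer P wstar \<and> outputs M P h w \<and>
    (w \<notin> feasible P \<or> objective P w - objective P wstar \<ge> G\<^sup>2 / (8 * \<alpha> * N))"
proof -
  let ?T = "N div (4 * k)"
  have T1: "k * ?T \<le> N" 
    using times_div_less_eq_dividend[of "4 * k" N] by linarith
  have T2: "?T + 1 < 5 * N" using N div_le_dividend[of N "4 * k"] by linarith
  have "\<exists>D a J \<sigma> h w. consistent D a J \<sigma> \<and> card D \<le> ?T \<and> (\<forall>P. agrees f s D a P \<longrightarrow> outputs M P h w)"
  proof (rule adversary_step)
    show "consistent {} (\<lambda>_. 0) {} (\<lambda>_. 1)" by (simp add: consistent_def)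
    show "history M P []" for P by (rule history.start)
  qed (use terminates T1 T2 in auto)
  then obtain D a J \<sigma> h w where D: "consistent D a J \<sigma>" "card D \<le> ?T"
    "\<And>P. agrees f s D a P \<Longrightarrow> outputs M P h w"
    by blast
  \<comment> \<open>The output \<open>w\<close> is the same on every agreeing instance, so the
    hidden vertex can be chosen orthogonal to \<open>w\<close> without changing the run.\<close>
  obtain P wstar where P: "admissible \<alpha> G (6 * N) k P" "agrees f s D a P"
    "wstar \<in> vertices (feasible P)" "unique_minimizer P wstar"
    "w \<in> feasible P \<Longrightarrow> objective P w - objective P wstar \<ge> \<alpha> / 2 * c\<^sup>2"
    using complete_instance[OF D(1), where x = w] D(2) T2 by auto
  then show ?thesis using D(3)[OF P(2)] gap by metis
qed

end

section \<open>The gap for a given budget and the resulting bound on the number of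
  projections\<close>

theorem theorem2:
  shows "(\<forall>(\<alpha>::real) (G::real) (N::nat) (k::nat) (M::rule).
      \<alpha> > 0 \<and> G > 0 \<and> N \<ge> 5 \<and> 1 \<le> k \<and> k \<le> 6 * N \<and> method_in_dim (6 * N) M \<and>
      (\<forall>P. admissible \<alpha> G (6 * N) k P \<longrightarrow>
         (\<exists>h w. outputs M P h w \<and> projection_calls h \<le> N div (4 * k))) \<longrightarrow>
      (\<exists>P wstar h w. admissible \<alpha> G (6 * N) k P \<and>
         wstar \<in> vertices (feasible P) \<and> unique_minimizer P wstar \<and> outputs M P h w \<and>
         (w \<notin> feasible P \<or>
          objective P w - objective P wstar \<ge> G\<^sup>2 / (36 * \<alpha> * real N))))
    \<and>
    (\<exists>c0 > (0::real). \<exists>X0::real. \<forall>(\<alpha>::real) (G::real) (\<epsilon>::real) (k::nat) (M :: nat \<Rightarrow> rule).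
      \<alpha> > 0 \<and> G > 0 \<and> \<epsilon> > 0 \<and> k \<ge> 1 \<and> G\<^sup>2 / (\<alpha> * \<epsilon> * real k) \<ge> X0 \<and>
      (\<forall>N. method_in_dim (6 * N) (M (6 * N))) \<and>
      (\<forall>N P. N \<ge> 5 \<and> k \<le> 6 * N \<and> admissible \<alpha> G (6 * N) k P \<longrightarrow>
         (\<exists>h w. outputs (M (6 * N)) P h w \<and> eps_optimal P \<epsilon> w)) \<longrightarrow>
      (\<exists>N P h w. N \<ge> 5 \<and> k \<le> 6 * N \<and> admissible \<alpha> G (6 * N) k P \<and>
         outputs (M (6 * N)) P h w \<and>
         real (projection_calls h) \<ge> c0 * G\<^sup>2 / (\<alpha> * \<epsilon> * real k)))"
    (is "?A \<and> (\<exists>c0>0. \<exists>X0. ?B c0 X0)")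
proof
  show A: ?A
  proof (intro allI impI, elim conjE)
    fix \<alpha> G :: real and N k :: nat and M :: rule
    assume *: "\<alpha> > 0" "G > 0" "N \<ge> 5" "1 \<le> k"
      and M: "\<forall>P. admissible \<alpha> G (6 * N) k P \<longrightarrow>
         (\<exists>h w. outputs M P h w \<and> projection_calls h \<le> N div (4 * k))"
    interpret hard_instance \<alpha> G N k by unfold_locales (use * in auto)
    have "G\<^sup>2 / (36 * \<alpha> * real N) \<le> G\<^sup>2 / (8 * \<alpha> * real N)"
      using * by (intro divide_left_mono) auto
    then show "\<exists>P wstar h w. admissible \<alpha> G (6 * N) k P \<and>
         wstar \<in> vertices (feasible P) \<and> unique_minimizer P wstar \<and> outputs M P h w \<and>
         (w \<notin> feasible P \<or> objective P w - objective P wstar \<ge> G\<^sup>2 / (36 * \<alpha> * real N))"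
      using lower_bound[of M] M by (meson order_trans)
  qed
  \<comment> \<open>With \<open>X = G\<^sup>2 / (\<alpha> * \<epsilon> * k)\<close>, the choice of
    \<open>N\<close> below gives \<open>N / (4 * k) \<ge> X / 144 - 1 / 4\<close>, and rounding down
    costs at most 1 more. The remaining \<open>X / 144 - 5 / 4\<close> is at least
    \<open>X / 288\<close> exactly when \<open>X \<ge> 360\<close>.\<close>
  have "?B (1 / 288) 360"
  proof (intro allI impI, elim conjE, rule ccontr)
    fix \<alpha> G \<epsilon> :: real and k :: nat and M :: "nat \<Rightarrow> rule"
    assume *: "\<alpha> > 0" "G > 0" "\<epsilon> > 0" "k \<ge> 1"
      and X: "360 \<le> G\<^sup>2 / (\<alpha> * \<epsilon> * real k)"
      and dim: "\<forall>N. method_in_dim (6 * N) (M (6 * N))"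
      and M: "\<forall>N P. N \<ge> 5 \<and> k \<le> 6 * N \<and> admissible \<alpha> G (6 * N) k P \<longrightarrow>
         (\<exists>h w. outputs (M (6 * N)) P h w \<and> eps_optimal P \<epsilon> w)"
      and few: "\<not> (\<exists>N P h w. N \<ge> 5 \<and> k \<le> 6 * N \<and> admissible \<alpha> G (6 * N) k P \<and>
         outputs (M (6 * N)) P h w \<and>
         real (projection_calls h) \<ge> 1 / 288 * G\<^sup>2 / (\<alpha> * \<epsilon> * real k))"
    define X where "X = G\<^sup>2 / (\<alpha> * \<epsilon> * real k)"
    define Y where "Y = X * real k / 36"
    have X360: "360 \<le> X" using X by (simp add: X_def)
    have Y: "Y = G\<^sup>2 / (36 * \<alpha> * \<epsilon>)" using * by (simp add: X_def Y_def)
    have "360 * real k \<le> X * real k" using X360 by (intro mult_right_mono) auto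
    then have Yk: "10 * real k \<le> Y" by (simp add: Y_def)
    \<comment> \<open>The largest integer strictly below \<open>Y\<close>. Strictness makes the gap
      \<open>G\<^sup>2 / (36 * \<alpha> * N)\<close> exceed \<open>\<epsilon>\<close>, as
      \<open>eps_optimal\<close> permits equality.\<close>
    define N where "N = nat (\<lceil>Y\<rceil> - 1)"
    have "real N = real_of_int (\<lceil>Y\<rceil> - 1)" using Yk * by (simp add: N_def)
    then have N: "real N < Y" "Y \<le> real N + 1" by linarith+
    have N5: "N \<ge> 5" and kN: "k \<le> 6 * N" using N Yk * by linarith+
    have "real N / real (4 * k) - 1 \<le> real (N div (4 * k))"
      using floor_correct[of "real N / real (4 * k)"] unfolding floor_divide_of_nat_eq by linarith
    moreover have "X / 144 - 1 / 4 \<le> real N / real (4 * k)"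
    proof -
      have "(Y - 1) / real (4 * k) \<le> real N / real (4 * k)"
        using N * by (intro divide_right_mono) auto
      moreover have "(Y - 1) / real (4 * k) = X / 144 - 1 / real (4 * k)"
        using * by (simp add: Y_def field_simps)
      moreover have "1 / real (4 * k) \<le> 1 / 4" using * by (simp add: field_simps)
      ultimately show ?thesis by linarith
    qed
    ultimately have div: "X / 288 \<le> real (N div (4 * k))" using X360 by linarith
    \<comment> \<open>A method that always needs fewer than \<open>X / 288\<close> calls stays
      within the budget of the first claim for this \<open>N\<close>.\<close>
    have "\<exists>h w. outputs (M (6 * N)) P h w \<and> projection_calls h \<le> N div (4 * k)"
      if P: "admissible \<alpha> G (6 * N) k P" for P
    proof -
      obtain h w where h: "outputs (M (6 * N)) P h w" using M N5 kN P by blast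
      then have "real (projection_calls h) < X / 288" using few N5 kN P by (force simp: X_def)
      then show ?thesis using h div by (intro exI[of _ h] exI[of _ w]) auto
    qed
    then obtain P wstar h w where P: "admissible \<alpha> G (6 * N) k P" "unique_minimizer P wstar"
      "outputs (M (6 * N)) P h w"
      "w \<notin> feasible P \<or> objective P w - objective P wstar \<ge> G\<^sup>2 / (36 * \<alpha> * real N)"
      using A[rule_format, of \<alpha> G N k "M (6 * N)"] * N5 kN dim by blast
    \<comment> \<open>The guarantee and the first claim each speak of some run on \<open>P\<close>;
      determinism identifies the two outputs.\<close>
    obtain h' w' where "outputs (M (6 * N)) P h' w'" "eps_optimal P \<epsilon> w'" using M N5 kN P(1) by blast
    then have opt: "eps_optimal P \<epsilon> w" using outputs_unique[OF P(3)] by blast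
    have "is_arg_min (objective P) (\<lambda>x. x \<in> feasible P) wstar"
      using P(2) by (auto simp: unique_minimizer_def)
    then have "(INF x\<in>feasible P. objective P x) = objective P wstar"
      by (intro cInf_eq_minimum) (auto simp: is_arg_min_def not_less)
    then have "G\<^sup>2 / (36 * \<alpha> * real N) \<le> \<epsilon>"
      using P(4) opt by (auto simp: eps_optimal_def)
    moreover have "\<epsilon> < G\<^sup>2 / (36 * \<alpha> * real N)"
      using N(1) N5 * by (simp add: Y field_simps)
    ultimately show False by simp
  qed
  then show "\<exists>c0>0. \<exists>X0. ?B c0 X0"
    by (intro exI[of _ "1 / 288"] conjI exI[of _ 360]) simp_all
qed

end
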